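(* Let $V$ be a real vector space, let $v_1,\ldots,v_d\in V$ be linearly independent, and for $i=0,\ldots,d$ let $\sigma^i=S(v_1,\ldots,v_i)$ and $\tau^{d-i}=S(v_{i+1},\ldots,v_d)$. Let $a,b>0$ and define \[A_i=a\sigma^i+b\tau^{d-i}+b(v_1+\cdots+v_i)\ (i\geqslant 0),\qquad B_i=a\sigma^{i-1}+b\tau^{d-i}+b(v_1+\cdots+v_i)\ (i\geqslant1).\] Then $(a+b)\sigma^d=A_0\cup\cdots\cup A_d$, and $(A_0\cup\cdots\cup A_{i-1})\cap A_i=B_i$ for $i\geqslant1$. Consequently, if $\varphi$ is a translation-invariant valuation on $\mathcal{K}(V)$ (with values in an abelian group), then \[\varphi((a+b)\sigma^d)=\sum_{i=0}^d\varphi(a\sigma^i+b\tau^{d-i})-\sum_{i=1}^d\varphi(a\sigma^{i-1}+b\tau^{d-i}).\]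
   Context: For linearly independent $w_1,\ldots,w_k$, $S(w_1,\ldots,w_k)=\{x_1w_1+\cdots+x_kw_k\mid 1\geqslant x_1\geqslant\cdots\geqslant x_k\geqslant0\}$, the $k$-simplex with vertices $0,w_1,w_1+w_2,\ldots,w_1+\cdots+w_k$; for $k=0$ it is $\{0\}$. Sums of sets are Minkowski sums, and adding a vector means translation. $\mathcal{K}(V)$ is the set of nonempty compact convex subsets of $V$; a valuation satisfies $\varphi(B\cup C)=\varphi(B)+\varphi(C)-\varphi(B\cap C)$ whenever $B,C,B\cup C\in\mathcal{K}(V)$. *)

theory Defs
  imports "HOL-Analysis.Analysis" "HOL-Library.Set_Algebras"
begin

text \<open>The simplex S(w_1,...,w_k) = {x_1 w_1 + ... + x_k w_k | 1 >= x_1 >= ... >= x_k >= 0},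
  for a list ws = [w_1,...,w_k]; for k = 0 this is {0}.\<close>
definition simplexS :: "'a::real_vector list \<Rightarrow> 'a set" where
  "simplexS ws = {(\<Sum>j<length ws. x j *\<^sub>R (ws ! j)) | x.
      (\<forall>j<length ws. 0 \<le> x j \<and> x j \<le> 1) \<and>
      (\<forall>j. Suc j < length ws \<longrightarrow> x (Suc j) \<le> x j)}"

text \<open>Nonempty compact convex sets.\<close>
definition Kset :: "'a::real_normed_vector set set" where
  "Kset = {K. K \<noteq> {} \<and> compact K \<and> convex K}"

definition is_valuation :: "('a::real_normed_vector set \<Rightarrow> 'g::ab_group_add) \<Rightarrow> bool" where
  "is_valuation \<phi> \<longleftrightarrow> (\<forall>B C. B \<in> Kset \<longrightarrow> C \<in> Kset \<longrightarrow> B \<union> C \<in> Kset \<longrightarrow>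
      \<phi> (B \<union> C) = \<phi> B + \<phi> C - \<phi> (B \<inter> C))"

definition translation_invariant :: "('a::real_normed_vector set \<Rightarrow> 'g) \<Rightarrow> bool" where
  "translation_invariant \<phi> \<longleftrightarrow> (\<forall>K \<in> Kset. \<forall>x. \<phi> ((\<lambda>y. x + y) ` K) = \<phi> K)"

end

theory Submission
  imports Defs "HOL-Library.Function_Algebras"
begin

text \<open>Encode the point y_0 v_1 + ... + y_(d-1) v_d by its coefficient sequence y; by independence
  the encoding is injective, so unions and intersections can be computed on coefficients. Then
  (a + b) sigma^d is the chain a + b >= y_0 >= ... >= y_(d-1) >= 0, and A_i is its part where
  y_j >= b for j < i and y_j <= b for j >= i: the hyperplanes y_j = b slice the chain into the
  cells A_i. Since y is decreasing, A_0 u ... u A_i is the convex set where y_j <= b for j >= i;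
  meeting it with A_(i+1), where y_j >= b for j <= i, forces y_i = b, which cuts out B_(i+1).
  Inclusion-exclusion for the valuation, one cell at a time, together with translation invariance,
  which removes the shifts b (v_1 + ... + v_i), gives the formula.\<close>

definition lincomb :: "'a::real_vector list \<Rightarrow> (nat \<Rightarrow> real) \<Rightarrow> 'a" where
  "lincomb vs y = (\<Sum>j<length vs. y j *\<^sub>R vs ! j)"

lemma lincomb_add: "lincomb vs (y + z) = lincomb vs y + lincomb vs z"
  by (simp add: lincomb_def scaleR_add_left sum.distrib)

lemma lincomb_supported:
  assumes "\<And>j. j \<notin> {m..<n} \<Longrightarrow> y j = 0" "n \<le> length vs"
  shows "lincomb vs y = (\<Sum>j<n - m. y (m + j) *\<^sub>R vs ! (m + j))"
proof -
  have "lincomb vs y = (\<Sum>j\<in>{m..<n}. y j *\<^sub>R vs ! j)"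
    unfolding lincomb_def using assms by (intro sum.mono_neutral_right) auto
  also have "\<dots> = (\<Sum>j<n - m. y (m + j) *\<^sub>R vs ! (m + j))"
    by (simp add: sum.atLeastLessThan_shift_0 atLeast0LessThan)
  finally show ?thesis .
qed

lemma lincomb_prefix_const:
  assumes "i \<le> length vs"
  shows "lincomb vs (\<lambda>j. if j < i then b else 0) = b *\<^sub>R sum_list (take i vs)"
  using lincomb_supported[of 0 i "\<lambda>j. if j < i then b else 0" vs] assms
  by (simp add: sum_list_sum_nth scaleR_sum_right atLeast0LessThan)

lemma inj_on_lincomb:
  assumes "distinct vs" "independent (set vs)"
  shows "inj_on (lincomb vs) {y. \<forall>j\<ge>length vs. y j = 0}"
proof (rule inj_onI)
  fix y y'
  assume y: "y \<in> {y. \<forall>j\<ge>length vs. y j = 0}" and y': "y' \<in> {y. \<forall>j\<ge>length vs. y j = 0}"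
    and eq: "lincomb vs y = lincomb vs y'"
  define c where "c = y - y'"
  define idx where "idx = the_inv_into {..<length vs} (nth vs)"
  have inj: "inj_on (nth vs) {..<length vs}" using assms(1) by (simp add: inj_on_nth)
  have idx: "idx (vs ! k) = k" if "k < length vs" for k
    unfolding idx_def using the_inv_into_f_f[OF inj] that by auto
  have "set vs = nth vs ` {..<length vs}" by (auto simp: set_conv_nth)
  then have "(\<Sum>v\<in>set vs. c (idx v) *\<^sub>R v) = (\<Sum>k<length vs. c (idx (vs ! k)) *\<^sub>R vs ! k)"
    by (simp add: sum.reindex[OF inj])
  also have "\<dots> = lincomb vs c" using idx by (simp add: lincomb_def)
  also have "\<dots> = 0" using eq lincomb_add[of vs c y'] by (simp add: c_def)
  finally have "\<forall>v\<in>set vs. c (idx v) = 0"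
    using assms(2) real_vector.dependent_finite[of "set vs"] by auto
  then have "c k = 0" if "k < length vs" for k using idx[OF that] that by (metis nth_mem)
  show "y = y'"
  proof
    fix j show "y j = y' j"
      using \<open>\<And>k. k < length vs \<Longrightarrow> c k = 0\<close> y y' by (cases "j < length vs") (auto simp: c_def)
  qed
qed

lemma continuous_on_lincomb: "continuous_on S (lincomb (vs :: 'a::real_normed_vector list))"
  unfolding lincomb_def
  by (intro continuous_intros continuous_on_subset[OF continuous_on_product_coordinates]) auto

lemma convex_lincomb_image:
  assumes "\<And>y z u. y \<in> Y \<Longrightarrow> z \<in> Y \<Longrightarrow> 0 \<le> u \<Longrightarrow> u \<le> 1
    \<Longrightarrow> (\<lambda>j. (1 - u) * y j + u * z j) \<in> Y"
  shows "convex (lincomb vs ` Y)"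
proof -
  have "(1 - u) *\<^sub>R lincomb vs y + u *\<^sub>R lincomb vs z = lincomb vs (\<lambda>j. (1 - u) * y j + u * z j)"
    for y z u
    by (simp add: lincomb_def scaleR_sum_right scaleR_add_left sum.distrib)
  then show ?thesis using assms by (auto simp: convex_alt)
qed

lemma image_set_plus_additive:
  assumes "\<And>x y. f (x + y) = f x + f y"
  shows "f ` (Y + Z) = f ` Y + f ` Z"
  by (force simp: set_plus_def assms)

definition chain_coeffs :: "nat \<Rightarrow> nat \<Rightarrow> real \<Rightarrow> (nat \<Rightarrow> real) set" where
  "chain_coeffs m n c = {y. (\<forall>j. j \<notin> {m..<n} \<longrightarrow> y j = 0) \<and> (\<forall>j\<in>{m..<n}. 0 \<le> y j \<and> y j \<le> c)
     \<and> (\<forall>j j'. m \<le> j \<longrightarrow> j \<le> j' \<longrightarrow> j' < n \<longrightarrow> y j' \<le> y j)}"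

lemma chain_coeffs_bounds:
  assumes "y \<in> chain_coeffs m n c" "0 \<le> c"
  shows "0 \<le> y j" "y j \<le> c"
  using assms by (cases "j \<in> {m..<n}"; auto simp: chain_coeffs_def)+

lemma chain_coeffs_antimono:
  assumes "y \<in> chain_coeffs m n c" "m \<le> j" "j \<le> j'" "j' < n"
  shows "y j' \<le> y j"
  using assms by (simp add: chain_coeffs_def)

lemma compact_chain_coeffs: "compact (chain_coeffs m n c)"
proof -
  define box where "box = Pi\<^sub>E UNIV (\<lambda>j. if j \<in> {m..<n} then {0..c} else {0::real})"
  define antimono where "antimono = {y. \<forall>j j'. m \<le> j \<longrightarrow> j \<le> j' \<longrightarrow> j' < n \<longrightarrow> y j' \<le> (y j :: real)}"
  have "compactin (product_topology (\<lambda>_. euclidean) UNIV) box"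
    unfolding box_def compactin_PiE by auto
  then have "compact box" by (simp add: euclidean_product_topology)
  moreover have "closed antimono"
    unfolding antimono_def
    by (intro closed_Collect_all closed_Collect_imp closed_Collect_le)
      (auto intro: continuous_on_product_coordinates)
  ultimately have "compact (box \<inter> antimono)" by (rule compact_Int_closed)
  moreover have "box \<inter> antimono = chain_coeffs m n c"
    by (auto simp: box_def antimono_def chain_coeffs_def PiE_iff split: if_splits)
  ultimately show ?thesis by simp
qed

lemma lift_Suc_antimono_le_bounded:
  fixes x :: "nat \<Rightarrow> 'a::order"
  assumes "\<forall>j. Suc j < n \<longrightarrow> x (Suc j) \<le> x j" "j \<le> j'" "j' < n"
  shows "x j' \<le> x j"
proof (rule lift_Suc_antimono_le_ivl[of "{k. Suc k < n}"])
  show "{j..<j'} \<subseteq> {k. Suc k < n}" using assms(3) by auto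
qed (use assms in auto)

lemma scaleR_simplexS_eq:
  assumes "m \<le> n" "n \<le> length vs" "c > 0"
  shows "(*\<^sub>R) c ` simplexS (take (n - m) (drop m vs)) = lincomb vs ` chain_coeffs m n c"
proof -
  let ?ws = "take (n - m) (drop m vs)"
  have len: "length ?ws = n - m" using assms by simp
  have nth: "?ws ! j = vs ! (m + j)" if "j < n - m" for j using that assms by simp
  have lincomb_eq: "lincomb vs y = (\<Sum>j<n - m. y (m + j) *\<^sub>R ?ws ! j)" if "y \<in> chain_coeffs m n c" for y
    using lincomb_supported[of m n y vs] that assms(2) nth by (simp add: chain_coeffs_def)
  show ?thesis
  proof
    show "(*\<^sub>R) c ` simplexS ?ws \<subseteq> lincomb vs ` chain_coeffs m n c"
    proof
      fix p assume "p \<in> (*\<^sub>R) c ` simplexS ?ws"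
      then obtain x where p: "p = c *\<^sub>R (\<Sum>j<n - m. x j *\<^sub>R ?ws ! j)"
        and x: "\<forall>j<n - m. 0 \<le> x j \<and> x j \<le> 1" "\<forall>j. Suc j < n - m \<longrightarrow> x (Suc j) \<le> x j"
        unfolding simplexS_def len by auto
      define y where "y = (\<lambda>j. if j \<in> {m..<n} then c * x (j - m) else 0)"
      have "y \<in> chain_coeffs m n c"
        using x assms(3) lift_Suc_antimono_le_bounded[OF x(2), of "_ - m" "_ - m"]
        by (auto simp: chain_coeffs_def y_def mult_left_le intro!: mult_left_mono)
      moreover have "p = lincomb vs y"
        using lincomb_eq[OF calculation] by (auto simp: p y_def scaleR_sum_right intro!: sum.cong)
      ultimately show "p \<in> lincomb vs ` chain_coeffs m n c" by blast
    qed
  next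
    show "lincomb vs ` chain_coeffs m n c \<subseteq> (*\<^sub>R) c ` simplexS ?ws"
    proof clarify
      fix y assume y: "y \<in> chain_coeffs m n c"
      define x where "x = (\<lambda>j. y (m + j) / c)"
      have "(\<Sum>j<n - m. x j *\<^sub>R ?ws ! j) \<in> simplexS ?ws"
        unfolding simplexS_def len using y assms(3)
        by (auto simp: x_def chain_coeffs_def intro!: divide_right_mono)
      moreover have "lincomb vs y = c *\<^sub>R (\<Sum>j<n - m. x j *\<^sub>R ?ws ! j)"
        using lincomb_eq[OF y] assms(3) by (simp add: x_def scaleR_sum_right)
      ultimately show "lincomb vs y \<in> (*\<^sub>R) c ` simplexS ?ws" by blast
    qed
  qed
qed

text \<open>With c = a + b, cut_coeffs d c b p q encodes the part of (a + b) sigma^d where the first p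
  coordinates are at least b and those from q on are at most b. The cells A_i and B_i are the cases
  (p, q) = (i, i) and (i, i - 1), and A_0 u ... u A_i is the case (0, i).\<close>

definition cut_coeffs :: "nat \<Rightarrow> real \<Rightarrow> real \<Rightarrow> nat \<Rightarrow> nat \<Rightarrow> (nat \<Rightarrow> real) set" where
  "cut_coeffs d c b p q = {y \<in> chain_coeffs 0 d c. (\<forall>j<p. b \<le> y j) \<and> (\<forall>j\<in>{q..<d}. y j \<le> b)}"

lemma chain_coeffs_sum_eq_cut_coeffs:
  assumes "k \<le> i" "i \<le> d" "0 \<le> a" "0 \<le> b"
  shows "chain_coeffs 0 k a + chain_coeffs i d b + {\<lambda>j. if j < i then b else 0}
    = cut_coeffs d (a + b) b i k"
proof
  show "chain_coeffs 0 k a + chain_coeffs i d b + {\<lambda>j. if j < i then b else 0}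
    \<subseteq> cut_coeffs d (a + b) b i k"
  proof
    fix y assume "y \<in> chain_coeffs 0 k a + chain_coeffs i d b + {\<lambda>j. if j < i then b else 0}"
    then obtain f g where f: "f \<in> chain_coeffs 0 k a" and g: "g \<in> chain_coeffs i d b"
      and y: "y = f + g + (\<lambda>j. if j < i then b else 0)"
      by (auto elim!: set_plus_elim)
    have yj: "y j = (if j < k then f j + b else if j < i then b else g j)" for j
      using f g assms(1) by (auto simp: y chain_coeffs_def)
    show "y \<in> cut_coeffs d (a + b) b i k"
      using f g assms unfolding cut_coeffs_def chain_coeffs_def yj
      by (auto simp: chain_coeffs_bounds(1)[OF f]
          intro: order_trans[OF chain_coeffs_bounds(2)[OF g]])
  qed
next
  show "cut_coeffs d (a + b) b i k
    \<subseteq> chain_coeffs 0 k a + chain_coeffs i d b + {\<lambda>j. if j < i then b else 0}"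
  proof
    fix y assume y: "y \<in> cut_coeffs d (a + b) b i k"
    define f where "f = (\<lambda>j. if j < k then y j - b else 0)"
    define g where "g = (\<lambda>j. if i \<le> j then y j else 0)"
    have "y j - b \<le> a" for j
      using y assms chain_coeffs_bounds(2)[of y 0 d "a + b" j] by (simp add: cut_coeffs_def)
    then have "f \<in> chain_coeffs 0 k a" "g \<in> chain_coeffs i d b"
      using y assms by (auto simp: f_def g_def cut_coeffs_def chain_coeffs_def)
    moreover have "y j = b" if "k \<le> j" "j < i" for j
      using y that assms(2) by (simp add: cut_coeffs_def order_antisym)
    then have "y = f + g + (\<lambda>j. if j < i then b else 0)"
      using y assms by (auto simp: f_def g_def cut_coeffs_def chain_coeffs_def fun_eq_iff)
    ultimately show "y \<in> chain_coeffs 0 k a + chain_coeffs i d b + {\<lambda>j. if j < i then b else 0}"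
      by blast
  qed
qed

lemma cut_coeffs_Int:
  "cut_coeffs d c b p q \<inter> cut_coeffs d c b p' q' = cut_coeffs d c b (max p p') (min q q')"
  unfolding cut_coeffs_def set_eq_iff Int_iff mem_Collect_eq Ball_def atLeastLessThan_iff
    less_max_iff_disj min_le_iff_disj by blast

lemma cut_coeffs_0_Suc:
  assumes "i < d"
  shows "cut_coeffs d c b 0 (Suc i) = cut_coeffs d c b 0 i \<union> cut_coeffs d c b (Suc i) (Suc i)"
proof
  show "cut_coeffs d c b 0 (Suc i) \<subseteq> cut_coeffs d c b 0 i \<union> cut_coeffs d c b (Suc i) (Suc i)"
  proof
    fix y assume y: "y \<in> cut_coeffs d c b 0 (Suc i)"
    then have chain: "y \<in> chain_coeffs 0 d c"
      and le_b: "\<And>j. Suc i \<le> j \<Longrightarrow> j < d \<Longrightarrow> y j \<le> b"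
      by (auto simp: cut_coeffs_def)
    show "y \<in> cut_coeffs d c b 0 i \<union> cut_coeffs d c b (Suc i) (Suc i)"
    proof (cases "y i \<le> b")
      case True
      then have "y j \<le> b" if "i \<le> j" "j < d" for j
        using le_b that by (cases "j = i") auto
      then show ?thesis using chain by (simp add: cut_coeffs_def)
    next
      case False
      have "b \<le> y j" if "j < Suc i" for j
        using chain_coeffs_antimono[OF chain, of j i] that assms False by simp
      then show ?thesis using chain le_b by (simp add: cut_coeffs_def)
    qed
  qed
qed (auto simp: cut_coeffs_def)

lemma UN_cut_coeffs:
  assumes "i \<le> d"
  shows "(\<Union>j\<in>{0..i}. cut_coeffs d c b j j) = cut_coeffs d c b 0 i"
  using assms
proof (induction i)
  case (Suc i)
  then show ?case by (simp add: atLeast0_atMost_Suc cut_coeffs_0_Suc Un_commute)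
qed simp

lemma closed_coordinate_halfspaces:
  "closed {y :: 'a \<Rightarrow> real. b \<le> y j}" "closed {y :: 'a \<Rightarrow> real. y j \<le> b}"
  by (intro closed_Collect_le continuous_on_const continuous_on_product_coordinates)+

lemma compact_cut_coeffs: "compact (cut_coeffs d c b p q)"
proof -
  have "cut_coeffs d c b p q
      = chain_coeffs 0 d c \<inter> (\<Inter>j<p. {y. b \<le> y j}) \<inter> (\<Inter>j\<in>{q..<d}. {y. y j \<le> b})"
    by (auto simp: cut_coeffs_def)
  then show ?thesis
    by (simp add: compact_Int_closed compact_chain_coeffs closed_INT closed_Int
        closed_coordinate_halfspaces)
qed

lemma convex_comb_mono:
  fixes u :: real
  assumes "0 \<le> u" "u \<le> 1" "x \<le> x'" "y \<le> y'"
  shows "(1 - u) * x + u * y \<le> (1 - u) * x' + u * y'"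
  using assms by (intro add_mono mult_left_mono) auto

lemma lincomb_cut_coeffs_in_Kset:
  assumes "p \<le> d" "0 \<le> b" "b \<le> c"
  shows "lincomb vs ` cut_coeffs d c b p q \<in> Kset"
proof -
  have "(\<lambda>j. if j < p then b else 0) \<in> cut_coeffs d c b p q"
    using assms by (auto simp: cut_coeffs_def chain_coeffs_def)
  moreover have "compact (lincomb vs ` cut_coeffs d c b p q)"
    by (intro compact_continuous_image continuous_on_lincomb compact_cut_coeffs)
  moreover have "convex (lincomb vs ` cut_coeffs d c b p q)"
  proof (rule convex_lincomb_image)
    fix y z and u :: real
    assume "y \<in> cut_coeffs d c b p q" "z \<in> cut_coeffs d c b p q" "0 \<le> u" "u \<le> 1"
    moreover have "(1 - u) * s + u * t \<le> r" if "s \<le> r" "t \<le> r" for s t r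
      using convex_comb_mono[OF \<open>0 \<le> u\<close> \<open>u \<le> 1\<close> that] by (simp add: algebra_simps)
    moreover have "r \<le> (1 - u) * s + u * t" if "r \<le> s" "r \<le> t" for s t r
      using convex_comb_mono[OF \<open>0 \<le> u\<close> \<open>u \<le> 1\<close> that] by (simp add: algebra_simps)
    ultimately show "(\<lambda>j. (1 - u) * y j + u * z j) \<in> cut_coeffs d c b p q"
      using convex_comb_mono[OF \<open>0 \<le> u\<close> \<open>u \<le> 1\<close>] by (simp add: cut_coeffs_def chain_coeffs_def)
  qed
  ultimately show ?thesis by (auto simp: Kset_def)
qed

definition simplex_cell :: "'a::real_vector list \<Rightarrow> real \<Rightarrow> real \<Rightarrow> nat \<Rightarrow> nat \<Rightarrow> 'a set" where
  "simplex_cell vs a b k i = (*\<^sub>R) a ` simplexS (take k vs) + (*\<^sub>R) b ` simplexS (drop i vs)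
     + {b *\<^sub>R sum_list (take i vs)}"

lemma simplex_cell_eq_lincomb_image:
  fixes vs :: "'a::real_vector list"
  assumes "k \<le> i" "i \<le> length vs" "0 < a" "0 < b"
  shows "simplex_cell vs a b k i = lincomb vs ` cut_coeffs (length vs) (a + b) b i k"
proof -
  have "(*\<^sub>R) a ` simplexS (take k vs) = lincomb vs ` chain_coeffs 0 k a"
    using scaleR_simplexS_eq[of 0 k vs a] assms by simp
  moreover have "(*\<^sub>R) b ` simplexS (drop i vs) = lincomb vs ` chain_coeffs i (length vs) b"
    using scaleR_simplexS_eq[of i "length vs" vs b] assms by simp
  moreover have "{b *\<^sub>R sum_list (take i vs)} = lincomb vs ` {\<lambda>j. if j < i then b else 0}"
    using lincomb_prefix_const[OF assms(2)] by simp
  ultimately have "simplex_cell vs a b k i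
    = lincomb vs ` (chain_coeffs 0 k a + chain_coeffs i (length vs) b + {\<lambda>j. if j < i then b else 0})"
    by (simp add: simplex_cell_def image_set_plus_additive[of "lincomb vs", OF lincomb_add])
  then show ?thesis
    using chain_coeffs_sum_eq_cut_coeffs[of k i "length vs" a b] assms by simp
qed

lemma UN_simplex_cell:
  fixes vs :: "'a::real_vector list"
  assumes "i \<le> length vs" "0 < a" "0 < b"
  shows "(\<Union>j\<in>{0..i}. simplex_cell vs a b j j)
    = lincomb vs ` cut_coeffs (length vs) (a + b) b 0 i"
proof -
  have "(\<Union>j\<in>{0..i}. simplex_cell vs a b j j)
      = lincomb vs ` (\<Union>j\<in>{0..i}. cut_coeffs (length vs) (a + b) b j j)"
    using assms by (simp add: image_UN simplex_cell_eq_lincomb_image)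
  then show ?thesis using UN_cut_coeffs[OF assms(1)] by simp
qed

lemma scaleR_simplexS_eq_UN_simplex_cell:
  fixes vs :: "'a::real_vector list"
  assumes "0 < a" "0 < b"
  shows "(*\<^sub>R) (a + b) ` simplexS vs = (\<Union>i\<in>{0..length vs}. simplex_cell vs a b i i)"
  using scaleR_simplexS_eq[of 0 "length vs" vs "a + b"] UN_simplex_cell[of "length vs" vs a b] assms
  by (simp add: cut_coeffs_def)

lemma UN_simplex_cell_Int:
  fixes vs :: "'a::real_vector list"
  assumes "distinct vs" "independent (set vs)" "1 \<le> i" "i \<le> length vs" "0 < a" "0 < b"
  shows "(\<Union>j\<in>{0..<i}. simplex_cell vs a b j j) \<inter> simplex_cell vs a b i i
    = simplex_cell vs a b (i - 1) i"
proof -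
  let ?cut = "cut_coeffs (length vs) (a + b) b"
  have "{0..<i} = {0..i - 1}" using assms(3) by auto
  then have "(\<Union>j\<in>{0..<i}. simplex_cell vs a b j j) = lincomb vs ` ?cut 0 (i - 1)"
    using UN_simplex_cell[of "i - 1" vs a b] assms(4-6) by simp
  then have "(\<Union>j\<in>{0..<i}. simplex_cell vs a b j j) \<inter> simplex_cell vs a b i i
      = lincomb vs ` ?cut 0 (i - 1) \<inter> lincomb vs ` ?cut i i"
    using assms(4-6) by (simp add: simplex_cell_eq_lincomb_image)
  also have "\<dots> = lincomb vs ` (?cut 0 (i - 1) \<inter> ?cut i i)"
    using inj_on_lincomb[OF assms(1,2)]
    by (rule inj_on_image_Int[symmetric]) (auto simp: cut_coeffs_def chain_coeffs_def)
  also have "\<dots> = simplex_cell vs a b (i - 1) i"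
    using assms by (simp add: cut_coeffs_Int simplex_cell_eq_lincomb_image)
  finally show ?thesis .
qed

lemma translation_invariant_set_plus_singleton:
  assumes "translation_invariant \<phi>" "K + {p} \<in> Kset"
  shows "\<phi> (K + {p}) = \<phi> K"
proof -
  have Kp: "K + {p} = (\<lambda>y. p + y) ` K"
    by (metis translation_eq_singleton_plus add.commute)
  have "compact K"
    using compact_translation[of "K + {p}" "- p"] assms(2) by (simp add: Kp Kset_def image_image)
  then have "K \<in> Kset"
    using assms(2) by (auto simp: Kp Kset_def)
  then show ?thesis using assms(1) by (simp add: Kp translation_invariant_def)
qed

lemma valuation_UN_eq_sum_diff:
  fixes n :: nat
  assumes val: "is_valuation \<phi>"
    and "\<And>i. i \<le> n \<Longrightarrow> A i \<in> Kset" "\<And>i. i \<le> n \<Longrightarrow> (\<Union>j\<in>{0..i}. A j) \<in> Kset"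
    and "\<And>i. 1 \<le> i \<Longrightarrow> i \<le> n \<Longrightarrow> (\<Union>j\<in>{0..<i}. A j) \<inter> A i = B i"
  shows "\<phi> (\<Union>i\<in>{0..n}. A i) = (\<Sum>i=0..n. \<phi> (A i)) - (\<Sum>i=1..n. \<phi> (B i))"
  using assms(2-4)
proof (induction n)
  case (Suc n)
  let ?U = "\<Union>j\<in>{0..n}. A j"
  have U_Suc: "(\<Union>j\<in>{0..Suc n}. A j) = ?U \<union> A (Suc n)"
    by (auto simp: atLeast0_atMost_Suc)
  have "?U \<inter> A (Suc n) = B (Suc n)"
    using Suc.prems(3)[of "Suc n"] by (simp add: atLeastLessThanSuc_atLeastAtMost)
  moreover have "\<phi> (?U \<union> A (Suc n)) = \<phi> ?U + \<phi> (A (Suc n)) - \<phi> (?U \<inter> A (Suc n))"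
    using val Suc.prems(1,2)[of n] Suc.prems(1,2)[of "Suc n"] U_Suc
    unfolding is_valuation_def by simp
  ultimately show ?case
    using Suc.IH Suc.prems by (simp add: U_Suc)
qed simp

lemma valuation_scaleR_simplexS:
  fixes vs :: "'a::euclidean_space list" and \<phi> :: "'a set \<Rightarrow> 'g::ab_group_add"
  assumes "distinct vs" "independent (set vs)" "0 < a" "0 < b"
    and "is_valuation \<phi>" "translation_invariant \<phi>"
  defines "K \<equiv> \<lambda>k i. (*\<^sub>R) a ` simplexS (take k vs) + (*\<^sub>R) b ` simplexS (drop i vs)"
  shows "\<phi> ((*\<^sub>R) (a + b) ` simplexS vs)
    = (\<Sum>i=0..length vs. \<phi> (K i i)) - (\<Sum>i=1..length vs. \<phi> (K (i - 1) i))"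
proof -
  let ?C = "simplex_cell vs a b"
  have C_in_Kset: "?C k i \<in> Kset" if "k \<le> i" "i \<le> length vs" for k i
    using that assms(3,4)
    by (simp add: simplex_cell_eq_lincomb_image lincomb_cut_coeffs_in_Kset)
  have \<phi>_C: "\<phi> (?C k i) = \<phi> (K k i)" if "k \<le> i" "i \<le> length vs" for k i
    using translation_invariant_set_plus_singleton[OF assms(6)] C_in_Kset[OF that]
    by (simp add: simplex_cell_def K_def)
  have "\<phi> ((*\<^sub>R) (a + b) ` simplexS vs) = \<phi> (\<Union>i\<in>{0..length vs}. ?C i i)"
    by (simp only: scaleR_simplexS_eq_UN_simplex_cell[OF assms(3,4)])
  also have "\<dots>
      = (\<Sum>i=0..length vs. \<phi> (?C i i)) - (\<Sum>i=1..length vs. \<phi> (?C (i - 1) i))"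
  proof (rule valuation_UN_eq_sum_diff[OF assms(5)])
    show "?C i i \<in> Kset" if "i \<le> length vs" for i
      using C_in_Kset that by simp
    show "(\<Union>j\<in>{0..i}. ?C j j) \<in> Kset" if "i \<le> length vs" for i
      using that assms(3,4) by (simp add: UN_simplex_cell lincomb_cut_coeffs_in_Kset)
    show "(\<Union>j\<in>{0..<i}. ?C j j) \<inter> ?C i i = ?C (i - 1) i" if "1 \<le> i" "i \<le> length vs" for i
      using UN_simplex_cell_Int[OF assms(1,2) that assms(3,4)] .
  qed
  also have "\<dots> = (\<Sum>i=0..length vs. \<phi> (K i i)) - (\<Sum>i=1..length vs. \<phi> (K (i - 1) i))"
    using \<phi>_C by (intro arg_cong2[where f = minus] sum.cong) auto
  finally show ?thesis .
qed

theorem lemma4p2: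
  fixes vs :: "'a::euclidean_space list" and a b :: real
    and \<phi> :: "'a set \<Rightarrow> 'g::ab_group_add"
  assumes "distinct vs" and "independent (set vs)"
    and "a > 0" and "b > 0"
  defines "d \<equiv> length vs"
  defines "\<sigma> \<equiv> \<lambda>i. simplexS (take i vs)"
  defines "\<tau> \<equiv> \<lambda>i. simplexS (drop i vs)"
  defines "A \<equiv> \<lambda>i. (*\<^sub>R) a ` \<sigma> i + (*\<^sub>R) b ` \<tau> i + {b *\<^sub>R sum_list (take i vs)}"
  defines "B \<equiv> \<lambda>i. (*\<^sub>R) a ` \<sigma> (i - 1) + (*\<^sub>R) b ` \<tau> i + {b *\<^sub>R sum_list (take i vs)}"
  shows "(*\<^sub>R) (a + b) ` \<sigma> d = (\<Union>i\<in>{0..d}. A i)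
    \<and> (\<forall>i\<in>{1..d}. (\<Union>j\<in>{0..<i}. A j) \<inter> A i = B i)
    \<and> (is_valuation \<phi> \<and> translation_invariant \<phi> \<longrightarrow>
           \<phi> ((*\<^sub>R) (a + b) ` \<sigma> d) =
             (\<Sum>i=0..d. \<phi> ((*\<^sub>R) a ` \<sigma> i + (*\<^sub>R) b ` \<tau> i))
           - (\<Sum>i=1..d. \<phi> ((*\<^sub>R) a ` \<sigma> (i - 1) + (*\<^sub>R) b ` \<tau> i)))"
proof -
  have A: "A = (\<lambda>i. simplex_cell vs a b i i)" and B: "B = (\<lambda>i. simplex_cell vs a b (i - 1) i)"
    by (simp_all add: A_def B_def \<sigma>_def \<tau>_def simplex_cell_def)
  have "(*\<^sub>R) (a + b) ` \<sigma> d = (\<Union>i\<in>{0..d}. A i)"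
    using scaleR_simplexS_eq_UN_simplex_cell[OF assms(3,4), of vs] by (simp add: A \<sigma>_def d_def)
  moreover have "\<forall>i\<in>{1..d}. (\<Union>j\<in>{0..<i}. A j) \<inter> A i = B i"
    using UN_simplex_cell_Int[OF assms(1,2) _ _ assms(3,4)] by (simp add: A B d_def)
  moreover have "is_valuation \<phi> \<and> translation_invariant \<phi> \<longrightarrow>
      \<phi> ((*\<^sub>R) (a + b) ` \<sigma> d) =
        (\<Sum>i=0..d. \<phi> ((*\<^sub>R) a ` \<sigma> i + (*\<^sub>R) b ` \<tau> i))
        - (\<Sum>i=1..d. \<phi> ((*\<^sub>R) a ` \<sigma> (i - 1) + (*\<^sub>R) b ` \<tau> i))"
    using valuation_scaleR_simplexS[OF assms(1-4)] by (auto simp: \<sigma>_def \<tau>_def d_def)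
  ultimately show ?thesis by blast
qed

end
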